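(* Let $R=\mathbb{K}[x_1,\ldots,x_n]$ be a polynomial ring in $n$ variables over a field $\mathbb{K}$, let $\mathbf{a}\in\mathbb{N}^n$, and let $I\subseteq R$ be an $\mathbf{a}$-determined monomial ideal generated in the same degree (i.e. all minimal monomial generators have the same degree). Then the special fiber ring of $I$ and that of its $\mathbf{a}$-dual $\widehat{I}^{[\mathbf{a}]}$ are isomorphic: $$\mathcal{F}(I)=\mathbb{K}[It]\cong \mathbb{K}[\widehat{I}^{[\mathbf{a}]}t]=\mathcal{F}(\widehat{I}^{[\mathbf{a}]}).$$
   Context: For a monomial ideal $I$, $G(I)$ denotes its minimal set of monomial generators. For $\mathbf{a}=(\mathbf{a}(1),\dots,\mathbf{a}(n))\in\mathbb{N}^n$ (with $0\in\mathbb{N}$), write $\mathbf{x}^{\mathbf{a}}=\prod_k x_k^{\mathbf{a}(k)}$. The ideal $I$ is $\mathbf{a}$-determined if every $f=\mathbf{x}^{\boldsymbol\alpha}\in G(I)$ satisfies $\boldsymbol\alpha(j)\le \mathbf{a}(j)$ for all $j$ (i.e. $f$ divides $\mathbf{x}^{\mathbf{a}}$). In that case the generalized Newton complementary dual of $I$ determined by $\mathbf{a}$ (the $\mathbf{a}$-dual) is the monomial ideal $\widehat{I}^{[\mathbf{a}]}$ with $G(\widehat{I}^{[\mathbf{a}]})=\{\mathbf{x}^{\mathbf{a}}/f \mid f\in G(I)\}$. If $I$ is a monomial ideal generated in the same degree with $G(I)=\{f_1,\dots,f_\nu\}$, its special fiber ring is the subring $\mathcal{F}(I)=\mathbb{K}[It]:=\mathbb{K}[f_1t,\dots,f_\nu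 t]\subset R[t]$, where $t$ is a new variable. *)

theory Defs
  imports
    "HOL-Library.Poly_Mapping"
    "HOL-Computational_Algebra.Polynomial"
begin

text \<open>
  A finite type \<open>'n\<close> indexes the variables, so \<open>\<nat>\<^sup>n\<close> is \<open>'n \<Rightarrow>\<^sub>0 nat\<close> and the polynomial ring
  \<open>R\<close> is the ring of finitely supported functions from exponents to \<open>'k\<close> with the convolution
  product. \<open>R[t]\<close> is \<open>R poly\<close>.
\<close>

type_synonym ('n, 'k) mpoly = "('n \<Rightarrow>\<^sub>0 nat) \<Rightarrow>\<^sub>0 'k"

definition xpow :: "('n \<Rightarrow>\<^sub>0 nat) \<Rightarrow> ('n, 'k::field) mpoly" where
  "xpow \<alpha> = Poly_Mapping.single \<alpha> 1"

definition mdeg :: "('n::finite \<Rightarrow>\<^sub>0 nat) \<Rightarrow> nat" where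
  "mdeg \<alpha> = (\<Sum>i\<in>UNIV. Poly_Mapping.lookup \<alpha> i)"

text \<open>The ideal generated by a set: the span in \<open>R\<close> regarded as a module over itself.\<close>

definition ideal_gen :: "('n, 'k::field) mpoly set \<Rightarrow> ('n, 'k) mpoly set" where
  "ideal_gen S = module.span (*) S"

definition monomial_ideal :: "('n, 'k::field) mpoly set \<Rightarrow> bool" where
  "monomial_ideal I \<longleftrightarrow> (\<exists>A. I = ideal_gen (xpow ` A))"

definition is_min_gens :: "('n, 'k::field) mpoly set \<Rightarrow> ('n, 'k) mpoly set \<Rightarrow> bool" where
  "is_min_gens I G \<longleftrightarrow>
     G \<subseteq> range xpow \<and> ideal_gen G = I \<and> (\<forall>H. H \<subset> G \<longrightarrow> ideal_gen H \<noteq> I)"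

text \<open>Existence and uniqueness for monomial ideals: \<open>is_min_gens_ex1\<close> below.\<close>

definition min_gens :: "('n, 'k::field) mpoly set \<Rightarrow> ('n, 'k) mpoly set" where
  "min_gens I = (THE G. is_min_gens I G)"

definition determined :: "('n \<Rightarrow>\<^sub>0 nat) \<Rightarrow> ('n, 'k::field) mpoly set \<Rightarrow> bool" where
  "determined a I \<longleftrightarrow>
     (\<forall>\<alpha>. xpow \<alpha> \<in> min_gens I \<longrightarrow>
        (\<forall>j. Poly_Mapping.lookup \<alpha> j \<le> Poly_Mapping.lookup a j))"

definition equigenerated :: "('n::finite, 'k::field) mpoly set \<Rightarrow> bool" where
  "equigenerated I \<longleftrightarrow> (\<exists>d. \<forall>\<alpha>. xpow \<alpha> \<in> min_gens I \<longrightarrow> mdeg \<alpha> = d)"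

text \<open>
  For \<open>f = xpow \<alpha>\<close> dividing \<open>xpow a\<close> the quotient is \<open>xpow (a - \<alpha>)\<close>. The subtraction is truncated,
  so the dual is meaningful only for \<open>a\<close>-determined monomial ideals; for those,
  \<open>dual_ex1\<close> below shows that it is well defined.
\<close>

definition newton_dual ::
    "('n \<Rightarrow>\<^sub>0 nat) \<Rightarrow> ('n, 'k::field) mpoly set \<Rightarrow> ('n, 'k) mpoly set" where
  "newton_dual a I =
     (THE J. monomial_ideal J \<and> min_gens J = {xpow (a - \<alpha>) | \<alpha>. xpow \<alpha> \<in> min_gens I})"

definition scalar :: "'k \<Rightarrow> ('n, 'k::field) mpoly poly" where
  "scalar c = [:Poly_Mapping.single 0 c:]"

definition subalgebra :: "('n, 'k::field) mpoly poly set \<Rightarrow> bool" where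
  "subalgebra A \<longleftrightarrow>
     range scalar \<subseteq> A \<and> (\<forall>p\<in>A. \<forall>q\<in>A. p + q \<in> A) \<and> (\<forall>p\<in>A. \<forall>q\<in>A. p * q \<in> A)"

text \<open>The polynomial \<open>f t\<close> of \<open>R[t]\<close> is \<open>monom f 1\<close>.\<close>

definition special_fiber :: "('n, 'k::field) mpoly set \<Rightarrow> ('n, 'k) mpoly poly set" where
  "special_fiber I = subalgebra hull ((\<lambda>f. monom f 1) ` min_gens I)"

text \<open>Isomorphism of \<open>'k\<close>-algebras; only the values of \<open>\<phi>\<close> on \<open>A\<close> matter.\<close>

definition algebra_isomorphic ::
    "('n, 'k::field) mpoly poly set \<Rightarrow> ('n, 'k) mpoly poly set \<Rightarrow> bool" where
  "algebra_isomorphic A B \<longleftrightarrow>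
     (\<exists>\<phi>. bij_betw \<phi> A B \<and>
        (\<forall>p\<in>A. \<forall>q\<in>A. \<phi> (p + q) = \<phi> p + \<phi> q) \<and>
        (\<forall>p\<in>A. \<forall>q\<in>A. \<phi> (p * q) = \<phi> p * \<phi> q) \<and>
        (\<forall>c. \<phi> (scalar c) = scalar c))"


subsection \<open>The minimal generators and the dual are well defined\<close>

lemma module_mult: "module ((*) :: 'a::comm_ring_1 \<Rightarrow> 'a \<Rightarrow> 'a)"
  by unfold_locales (simp_all add: algebra_simps)

lemma inj_xpow: "inj (xpow :: ('n \<Rightarrow>\<^sub>0 nat) \<Rightarrow> ('n, 'k::field) mpoly)"
proof (rule injI)
  fix \<alpha> \<beta> :: "'n \<Rightarrow>\<^sub>0 nat"
  assume "(xpow \<alpha> :: ('n, 'k) mpoly) = xpow \<beta>"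
  then have "Poly_Mapping.keys (xpow \<alpha> :: ('n, 'k) mpoly) = Poly_Mapping.keys (xpow \<beta> :: ('n, 'k) mpoly)"
    by simp
  then show "\<alpha> = \<beta>" by (simp add: xpow_def)
qed

lemma xpow_eq_iff [simp]: "(xpow \<alpha> :: ('n, 'k::field) mpoly) = xpow \<beta> \<longleftrightarrow> \<alpha> = \<beta>"
  using inj_xpow by (auto dest: injD)

lemma xpow_in_image_iff [simp]: "(xpow \<alpha> :: ('n, 'k::field) mpoly) \<in> xpow ` A \<longleftrightarrow> \<alpha> \<in> A"
  by auto

definition expdvd :: "('n \<Rightarrow>\<^sub>0 nat) \<Rightarrow> ('n \<Rightarrow>\<^sub>0 nat) \<Rightarrow> bool" where
  "expdvd \<alpha> \<beta> \<longleftrightarrow> (\<forall>j. Poly_Mapping.lookup \<alpha> j \<le> Poly_Mapping.lookup \<beta> j)"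

lemma expdvd_refl: "expdvd \<alpha> \<alpha>"
  by (simp add: expdvd_def)

lemma expdvd_trans: "expdvd \<alpha> \<beta> \<Longrightarrow> expdvd \<beta> \<gamma> \<Longrightarrow> expdvd \<alpha> \<gamma>"
  unfolding expdvd_def using le_trans by blast

lemma expdvd_antisym: "expdvd \<alpha> \<beta> \<Longrightarrow> expdvd \<beta> \<alpha> \<Longrightarrow> \<alpha> = \<beta>"
  unfolding expdvd_def by (intro poly_mapping_eqI) (simp add: le_antisym)

lemma expdvd_add: "expdvd \<alpha> (\<gamma> + \<alpha>)"
  by (simp add: expdvd_def lookup_add)

lemma expdvd_diff: "expdvd \<alpha> \<beta> \<Longrightarrow> (\<beta> - \<alpha>) + \<alpha> = \<beta>"
  unfolding expdvd_def by (intro poly_mapping_eqI) (simp add: lookup_add lookup_minus)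

lemma xpow_in_ideal_gen_iff:
  "(xpow \<beta> :: ('n, 'k::field) mpoly) \<in> ideal_gen (xpow ` A) \<longleftrightarrow> (\<exists>\<alpha>\<in>A. expdvd \<alpha> \<beta>)"
proof
  interpret module "(*) :: ('n, 'k) mpoly \<Rightarrow> _ \<Rightarrow> _" by (rule module_mult)
  let ?T = "{p :: ('n, 'k) mpoly. \<forall>\<beta>\<in>Poly_Mapping.keys p. \<exists>\<alpha>\<in>A. expdvd \<alpha> \<beta>}"
  have "subspace ?T"
  proof (rule subspaceI)
    fix x y :: "('n, 'k) mpoly"
    assume "x \<in> ?T" "y \<in> ?T"
    then show "x + y \<in> ?T" using keys_add[of x y] by blast
  next
    fix c x :: "('n, 'k) mpoly"
    assume x: "x \<in> ?T"
    show "c * x \<in> ?T"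
    proof (intro CollectI ballI)
      fix \<beta> assume "\<beta> \<in> Poly_Mapping.keys (c * x)"
      then obtain u v where uv: "\<beta> = u + v" "v \<in> Poly_Mapping.keys x"
        using keys_mult[of c x] by blast
      then obtain \<alpha> where "\<alpha> \<in> A" "expdvd \<alpha> v" using x by blast
      then show "\<exists>\<alpha>\<in>A. expdvd \<alpha> \<beta>" using uv expdvd_add expdvd_trans by blast
    qed
  qed simp
  moreover have "xpow ` A \<subseteq> ?T"
    by (auto simp: xpow_def intro: expdvd_refl)
  ultimately have "ideal_gen (xpow ` A) \<subseteq> ?T"
    unfolding ideal_gen_def by (intro span_minimal)
  moreover assume "(xpow \<beta> :: ('n, 'k) mpoly) \<in> ideal_gen (xpow ` A)"
  ultimately have "(xpow \<beta> :: ('n, 'k) mpoly) \<in> ?T" by blast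
  then show "\<exists>\<alpha>\<in>A. expdvd \<alpha> \<beta>" by (simp add: xpow_def)
next
  interpret module "(*) :: ('n, 'k) mpoly \<Rightarrow> _ \<Rightarrow> _" by (rule module_mult)
  assume "\<exists>\<alpha>\<in>A. expdvd \<alpha> \<beta>"
  then obtain \<alpha> where \<alpha>: "\<alpha> \<in> A" "expdvd \<alpha> \<beta>" by blast
  then have "(xpow \<beta> :: ('n, 'k) mpoly) = xpow (\<beta> - \<alpha>) * xpow \<alpha>"
    by (simp add: xpow_def mult_single expdvd_diff)
  moreover have "xpow (\<beta> - \<alpha>) * xpow \<alpha> \<in> span (xpow ` A)"
    using \<alpha>(1) by (intro span_scale span_base) simp
  ultimately show "(xpow \<beta> :: ('n, 'k) mpoly) \<in> ideal_gen (xpow ` A)"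
    unfolding ideal_gen_def by simp
qed

lemma ideal_gen_xpow_subset_iff:
  "(ideal_gen (xpow ` A) :: ('n, 'k::field) mpoly set) \<subseteq> ideal_gen (xpow ` B) \<longleftrightarrow>
     (\<forall>\<alpha>\<in>A. \<exists>\<beta>\<in>B. expdvd \<beta> \<alpha>)"
proof -
  interpret module "(*) :: ('n, 'k) mpoly \<Rightarrow> _ \<Rightarrow> _" by (rule module_mult)
  have "(ideal_gen (xpow ` A) :: ('n, 'k) mpoly set) \<subseteq> ideal_gen (xpow ` B) \<longleftrightarrow>
      (xpow ` A :: ('n, 'k) mpoly set) \<subseteq> ideal_gen (xpow ` B)"
    unfolding ideal_gen_def by (meson order_trans span_minimal span_superset subspace_span)
  also have "\<dots> \<longleftrightarrow> (\<forall>\<alpha>\<in>A. \<exists>\<beta>\<in>B. expdvd \<beta> \<alpha>)"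
    by (simp add: image_subset_iff xpow_in_ideal_gen_iff)
  finally show ?thesis .
qed

lemma is_min_gens_antichain:
  assumes anti: "\<And>\<alpha> \<beta>. \<alpha> \<in> A \<Longrightarrow> \<beta> \<in> A \<Longrightarrow> expdvd \<alpha> \<beta> \<Longrightarrow> \<alpha> = \<beta>"
  shows "is_min_gens (ideal_gen (xpow ` A)) G \<longleftrightarrow> G = (xpow ` A :: ('n, 'k::field) mpoly set)"
proof
  let ?I = "ideal_gen (xpow ` A) :: ('n, 'k) mpoly set"
  assume "is_min_gens ?I G"
  then have G: "G \<subseteq> range xpow" "ideal_gen G = ?I"
    and min: "\<And>H. H \<subset> G \<Longrightarrow> ideal_gen H \<noteq> ?I"
    by (auto simp: is_min_gens_def)
  from G(1) obtain C where C: "G = xpow ` C" by (auto simp: subset_image_iff)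
  have 1: "\<forall>\<alpha>\<in>A. \<exists>\<gamma>\<in>C. expdvd \<gamma> \<alpha>" and 2: "\<forall>\<gamma>\<in>C. \<exists>\<alpha>\<in>A. expdvd \<alpha> \<gamma>"
    using G(2) ideal_gen_xpow_subset_iff[where 'k = 'k] unfolding C by blast+
  have "A \<subseteq> C"
  proof
    fix \<alpha> assume \<alpha>: "\<alpha> \<in> A"
    then obtain \<gamma> where \<gamma>: "\<gamma> \<in> C" "expdvd \<gamma> \<alpha>" using 1 by blast
    then obtain \<alpha>' where \<alpha>': "\<alpha>' \<in> A" "expdvd \<alpha>' \<gamma>" using 2 by blast
    then have "\<alpha>' = \<alpha>" using anti \<alpha> \<gamma>(2) expdvd_trans by blast
    then show "\<alpha> \<in> C" using \<gamma> \<alpha>' expdvd_antisym by blast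
  qed
  then have "xpow ` A \<subseteq> G" using C by blast
  then show "G = xpow ` A" using min[of "xpow ` A"] by (auto simp: psubset_eq)
next
  assume G: "G = (xpow ` A :: ('n, 'k) mpoly set)"
  have "ideal_gen H \<noteq> ideal_gen G" if HG: "H \<subset> G" for H
  proof
    assume eq: "ideal_gen H = ideal_gen G"
    have "H \<subseteq> xpow ` A" using HG G by blast
    then obtain C where C: "H = xpow ` C" "C \<subseteq> A"
      unfolding subset_image_iff by blast
    then obtain \<alpha> where \<alpha>: "\<alpha> \<in> A" "\<alpha> \<notin> C" using HG G by blast
    have "\<forall>\<alpha>\<in>A. \<exists>\<gamma>\<in>C. expdvd \<gamma> \<alpha>"
      using eq ideal_gen_xpow_subset_iff[where 'k = 'k] unfolding G C by blast
    then show False using \<alpha> C(2) anti by blast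
  qed
  then show "is_min_gens (ideal_gen (xpow ` A)) G"
    using G by (auto simp: is_min_gens_def)
qed

lemma min_gens_antichain:
  assumes "\<And>\<alpha> \<beta>. \<alpha> \<in> A \<Longrightarrow> \<beta> \<in> A \<Longrightarrow> expdvd \<alpha> \<beta> \<Longrightarrow> \<alpha> = \<beta>"
  shows "min_gens (ideal_gen (xpow ` A)) = (xpow ` A :: ('n, 'k::field) mpoly set)"
  unfolding min_gens_def using is_min_gens_antichain[of A, OF assms]
  by (intro the_equality) blast+

lemma monomial_ideal_antichainE:
  fixes I :: "('n::finite, 'k::field) mpoly set"
  assumes "monomial_ideal I"
  obtains A where "I = ideal_gen (xpow ` A)"
    "\<And>\<alpha> \<beta>. \<alpha> \<in> A \<Longrightarrow> \<beta> \<in> A \<Longrightarrow> expdvd \<alpha> \<beta> \<Longrightarrow> \<alpha> = \<beta>"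
proof -
  obtain S where S: "I = ideal_gen (xpow ` S)"
    using assms by (auto simp: monomial_ideal_def)
  define A where "A = {\<alpha>\<in>S. \<forall>\<beta>\<in>S. expdvd \<beta> \<alpha> \<longrightarrow> \<beta> = \<alpha>}"
  have less: "mdeg \<beta> < mdeg \<alpha>" if "expdvd \<beta> \<alpha>" "\<beta> \<noteq> \<alpha>" for \<alpha> \<beta> :: "'n \<Rightarrow>\<^sub>0 nat"
  proof -
    obtain j where "Poly_Mapping.lookup \<beta> j \<noteq> Poly_Mapping.lookup \<alpha> j"
      using \<open>\<beta> \<noteq> \<alpha>\<close> by (meson poly_mapping_eqI)
    then show ?thesis using that(1)
      unfolding mdeg_def expdvd_def by (intro sum_strict_mono_ex1) (auto simp: order_less_le)
  qed
  have "\<exists>\<beta>\<in>A. expdvd \<beta> \<alpha>" if "\<alpha> \<in> S" for \<alpha>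
    using that
  proof (induction "mdeg \<alpha>" arbitrary: \<alpha> rule: less_induct)
    case less': less
    show ?case
    proof (cases "\<alpha> \<in> A")
      case True
      then show ?thesis using expdvd_refl by blast
    next
      case False
      then obtain \<beta> where "\<beta> \<in> S" "expdvd \<beta> \<alpha>" "\<beta> \<noteq> \<alpha>"
        using less'.prems by (auto simp: A_def)
      then show ?thesis using less'.hyps less expdvd_trans by blast
    qed
  qed
  moreover have "\<forall>\<alpha>\<in>A. \<exists>\<beta>\<in>S. expdvd \<beta> \<alpha>"
    using expdvd_refl by (auto simp: A_def)
  ultimately have "I = ideal_gen (xpow ` A)"
    unfolding S by (intro equalityI) (simp_all add: ideal_gen_xpow_subset_iff)
  moreover have "\<And>\<alpha> \<beta>. \<alpha> \<in> A \<Longrightarrow> \<beta> \<in> A \<Longrightarrow> expdvd \<alpha> \<beta> \<Longrightarrow> \<alpha> = \<beta>"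
    by (auto simp: A_def)
  ultimately show ?thesis by (rule that)
qed

lemma is_min_gens_ex1:
  fixes I :: "('n::finite, 'k::field) mpoly set"
  assumes "monomial_ideal I"
  shows "\<exists>!G. is_min_gens I G"
  using assms by (rule monomial_ideal_antichainE) (simp add: is_min_gens_antichain)

lemma is_min_gens_min_gens:
  fixes I :: "('n::finite, 'k::field) mpoly set"
  assumes "monomial_ideal I"
  shows "is_min_gens I (min_gens I)"
  unfolding min_gens_def by (rule theI') (rule is_min_gens_ex1[OF assms])

lemma dual_ex1:
  fixes I :: "('n::finite, 'k::field) mpoly set"
  assumes "monomial_ideal I" and det: "determined a I"
  shows "\<exists>!J :: ('n, 'k) mpoly set. monomial_ideal J \<and> min_gens J = {xpow (a - \<alpha>) | \<alpha>. xpow \<alpha> \<in> min_gens I}"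
proof -
  obtain A where A: "I = ideal_gen (xpow ` A)"
    and anti: "\<And>\<alpha> \<beta>. \<alpha> \<in> A \<Longrightarrow> \<beta> \<in> A \<Longrightarrow> expdvd \<alpha> \<beta> \<Longrightarrow> \<alpha> = \<beta>"
    using monomial_ideal_antichainE[OF assms(1)] by metis
  have G: "min_gens I = xpow ` A"
    unfolding A using anti by (rule min_gens_antichain)
  have le: "expdvd \<alpha> a" if "\<alpha> \<in> A" for \<alpha>
    using det that by (auto simp: determined_def G expdvd_def)
  have swap: "expdvd \<beta> \<alpha>" if "\<alpha> \<in> A" "\<beta> \<in> A" "expdvd (a - \<alpha>) (a - \<beta>)" for \<alpha> \<beta>
    unfolding expdvd_def
  proof
    fix j
    have "Poly_Mapping.lookup a j - Poly_Mapping.lookup \<alpha> j \<le>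
        Poly_Mapping.lookup a j - Poly_Mapping.lookup \<beta> j"
      "Poly_Mapping.lookup \<beta> j \<le> Poly_Mapping.lookup a j"
      using that(3) le[OF that(2)] by (simp_all add: expdvd_def lookup_minus)
    then show "Poly_Mapping.lookup \<beta> j \<le> Poly_Mapping.lookup \<alpha> j" by linarith
  qed
  let ?D = "xpow ` (-) a ` A :: ('n, 'k) mpoly set"
  have D: "{xpow (a - \<alpha>) | \<alpha>. xpow \<alpha> \<in> min_gens I} = ?D"
    by (auto simp: G)
  have "min_gens (ideal_gen ?D) = ?D"
    using anti swap by (intro min_gens_antichain) blast
  then have "monomial_ideal (ideal_gen ?D) \<and> min_gens (ideal_gen ?D) = ?D"
    by (auto simp: monomial_ideal_def)
  moreover have "J = ideal_gen ?D" if "monomial_ideal J \<and> min_gens J = ?D" for J :: "('n, 'k) mpoly set"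
    using is_min_gens_min_gens[of J] that by (simp add: is_min_gens_def)
  ultimately show ?thesis unfolding D by (rule ex1I)
qed

end

theory Submission
  imports Defs
begin

text \<open>
  The linear map sending \<open>x^b t^m\<close> to \<open>x^(m a - b) t^m\<close> is an involutive algebra automorphism of the
  subalgebra of \<open>R[t]\<close> spanned by the monomials with \<open>b \<le> m a\<close>. It swaps \<open>f t\<close> and
  \<open>(x^a / f) t\<close> for every divisor \<open>f\<close> of \<open>x^a\<close>, hence it swaps the algebras generated by the
  \<open>f t\<close> with \<open>f\<close> in \<open>G(I)\<close> and with \<open>f\<close> in the generators of the dual.
\<close>

text \<open>Summing \<open>single\<close> terms, instead of reindexing coefficients, keeps the map
  additive on all of R: truncation may merge exponents, and their coefficients then add up.\<close>

definition reflect :: "('n \<Rightarrow>\<^sub>0 nat) \<Rightarrow> ('n, 'k::field) mpoly \<Rightarrow> ('n, 'k) mpoly" where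
  "reflect c q = (\<Sum>b\<in>Poly_Mapping.keys q. Poly_Mapping.single (c - b) (Poly_Mapping.lookup q b))"

text \<open>Extra exponents have coefficient 0. This lets \<open>p\<close>, \<open>q\<close> and
  \<open>p + q\<close> be summed over one common index set.\<close>

lemma reflect_superset:
  assumes "finite F" "Poly_Mapping.keys q \<subseteq> F"
  shows "reflect c q = (\<Sum>b\<in>F. Poly_Mapping.single (c - b) (Poly_Mapping.lookup q b))"
  unfolding reflect_def using assms
  by (intro sum.mono_neutral_left) (auto simp: in_keys_iff)

lemma reflect_0 [simp]: "reflect c 0 = 0"
  by (simp add: reflect_def)

lemma reflect_single [simp]:
  "reflect c (Poly_Mapping.single b k) = Poly_Mapping.single (c - b) k"
  by (subst reflect_superset[of "{b}"]) auto

lemma reflect_add: "reflect c (p + q) = reflect c p + reflect c q"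
proof -
  let ?F = "Poly_Mapping.keys p \<union> Poly_Mapping.keys q"
  show ?thesis
    using keys_add[of p q]
    by (simp add: reflect_superset[of ?F] lookup_add single_add sum.distrib)
qed

lemma reflect_sum: "reflect c (sum f A) = (\<Sum>x\<in>A. reflect c (f x))"
  by (induction A rule: infinite_finite_induct) (simp_all add: reflect_add)

lemma sum_single_keys:
  "(\<Sum>b\<in>Poly_Mapping.keys q. Poly_Mapping.single b (Poly_Mapping.lookup q b)) = q"
proof (rule poly_mapping_eqI)
  fix k
  show "Poly_Mapping.lookup (\<Sum>b\<in>Poly_Mapping.keys q. Poly_Mapping.single b (Poly_Mapping.lookup q b)) k
      = Poly_Mapping.lookup q k"
    by (simp add: lookup_sum lookup_single when_def in_keys_iff)
qed

lemma diff_diff_expdvd: "expdvd b c \<Longrightarrow> c - (c - b) = b"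
  by (intro poly_mapping_eqI) (simp add: expdvd_def lookup_minus)

lemma diff_add_expdvd: "expdvd b c \<Longrightarrow> expdvd b' c' \<Longrightarrow> c + c' - (b + b') = (c - b) + (c' - b')"
  by (intro poly_mapping_eqI) (simp add: expdvd_def lookup_minus lookup_add)

lemma expdvd_add_mono: "expdvd b c \<Longrightarrow> expdvd b' c' \<Longrightarrow> expdvd (b + b') (c + c')"
  by (simp add: expdvd_def lookup_add add_mono)

lemma reflect_reflect:
  assumes "\<And>b. b \<in> Poly_Mapping.keys q \<Longrightarrow> expdvd b c"
  shows "reflect c (reflect c q) = q"
proof -
  have "reflect c (reflect c q) =
      (\<Sum>b\<in>Poly_Mapping.keys q. Poly_Mapping.single (c - (c - b)) (Poly_Mapping.lookup q b))"
    \<comment> \<open>Only the inner reflection is unfolded; \<open>reflect_sum\<close> carries the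
      outer one to single terms.\<close>
    unfolding reflect_def[of c q] by (simp add: reflect_sum)
  also have "\<dots> = (\<Sum>b\<in>Poly_Mapping.keys q. Poly_Mapping.single b (Poly_Mapping.lookup q b))"
    using assms by (intro sum.cong) (simp_all add: diff_diff_expdvd)
  finally show ?thesis by (simp add: sum_single_keys)
qed

text \<open>By bilinearity it suffices to compare products of terms. There the divisibility bounds
  rule out truncation, so \<open>c + c' - (b + b')\<close> splits as
  \<open>(c - b) + (c' - b')\<close>.\<close>

lemma reflect_mult:
  assumes "\<And>b. b \<in> Poly_Mapping.keys p \<Longrightarrow> expdvd b c"
    and "\<And>b. b \<in> Poly_Mapping.keys q \<Longrightarrow> expdvd b c'"
  shows "reflect (c + c') (p * q) = reflect c p * reflect c' q"
proof -
  have "p * q = (\<Sum>b\<in>Poly_Mapping.keys p. Poly_Mapping.single b (Poly_Mapping.lookup p b)) *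
      (\<Sum>b\<in>Poly_Mapping.keys q. Poly_Mapping.single b (Poly_Mapping.lookup q b))"
    by (simp only: sum_single_keys)
  also have "\<dots> = (\<Sum>b\<in>Poly_Mapping.keys p. \<Sum>b'\<in>Poly_Mapping.keys q.
      Poly_Mapping.single (b + b') (Poly_Mapping.lookup p b * Poly_Mapping.lookup q b'))"
    by (simp add: sum_product mult_single)
  finally have "reflect (c + c') (p * q) = (\<Sum>b\<in>Poly_Mapping.keys p. \<Sum>b'\<in>Poly_Mapping.keys q.
      Poly_Mapping.single (c + c' - (b + b')) (Poly_Mapping.lookup p b * Poly_Mapping.lookup q b'))"
    by (simp add: reflect_sum)
  also have "\<dots> = (\<Sum>b\<in>Poly_Mapping.keys p. \<Sum>b'\<in>Poly_Mapping.keys q.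
      Poly_Mapping.single (c - b) (Poly_Mapping.lookup p b) *
      Poly_Mapping.single (c' - b') (Poly_Mapping.lookup q b'))"
    using assms by (intro sum.cong refl) (simp add: diff_add_expdvd mult_single)
  finally show ?thesis by (simp add: reflect_def sum_product)
qed

definition nscale :: "nat \<Rightarrow> ('n \<Rightarrow>\<^sub>0 nat) \<Rightarrow> ('n \<Rightarrow>\<^sub>0 nat)" where
  "nscale m a = Poly_Mapping.map ((*) m) a"

lemma lookup_nscale [simp]: "Poly_Mapping.lookup (nscale m a) j = m * Poly_Mapping.lookup a j"
  by (simp add: nscale_def Poly_Mapping.map.rep_eq when_def)

lemma nscale_0 [simp]: "nscale 0 a = 0"
  by (intro poly_mapping_eqI) simp

lemma nscale_1 [simp]: "nscale (Suc 0) a = a"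
  by (intro poly_mapping_eqI) simp

lemma nscale_add: "nscale (m + n) a = nscale m a + nscale n a"
  by (intro poly_mapping_eqI) (simp add: lookup_add algebra_simps)

definition reflect_poly_t ::
    "('n \<Rightarrow>\<^sub>0 nat) \<Rightarrow> ('n, 'k::field) mpoly poly \<Rightarrow> ('n, 'k) mpoly poly" where
  "reflect_poly_t a p = (\<Sum>m\<le>degree p. monom (reflect (nscale m a) (coeff p m)) m)"

text \<open>Beyond the degree both sides vanish, so later identities can be checked coefficient by
  coefficient with no regard to degrees.\<close>

lemma coeff_reflect_poly_t [simp]:
  "coeff (reflect_poly_t a p) m = reflect (nscale m a) (coeff p m)"
  by (cases "m \<le> degree p") (simp_all add: reflect_poly_t_def coeff_sum coeff_eq_0)

text \<open>The domain on which no subtraction in \<open>reflect_poly_t\<close> is truncated. Its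
  part of t-degree 0 consists of the scalars.\<close>

definition bounded_polys :: "('n \<Rightarrow>\<^sub>0 nat) \<Rightarrow> ('n, 'k::field) mpoly poly set" where
  "bounded_polys a = {p. \<forall>m. \<forall>b\<in>Poly_Mapping.keys (coeff p m). expdvd b (nscale m a)}"

lemma reflect_poly_t_add:
  "reflect_poly_t a (p + q) = reflect_poly_t a p + reflect_poly_t a q"
  by (intro poly_eqI) (simp add: reflect_add)

text \<open>In the convolution for t^k, the summand with index i is covered by
  \<open>reflect_mult\<close>, because k a = i a + (k - i) a.\<close>

lemma reflect_poly_t_mult:
  assumes "p \<in> bounded_polys a" "q \<in> bounded_polys a"
  shows "reflect_poly_t a (p * q) = reflect_poly_t a p * reflect_poly_t a q"
proof (rule poly_eqI)
  fix k
  have "reflect (nscale k a) (coeff p i * coeff q (k - i)) =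
      reflect (nscale i a) (coeff p i) * reflect (nscale (k - i) a) (coeff q (k - i))"
    if "i \<le> k" for i
    using assms that reflect_mult[of "coeff p i" "nscale i a" "coeff q (k - i)" "nscale (k - i) a"]
    by (auto simp: bounded_polys_def simp flip: nscale_add)
  then show "coeff (reflect_poly_t a (p * q)) k = coeff (reflect_poly_t a p * reflect_poly_t a q) k"
    by (simp add: coeff_mult reflect_sum)
qed

lemma reflect_poly_t_involution:
  "p \<in> bounded_polys a \<Longrightarrow> reflect_poly_t a (reflect_poly_t a p) = p"
  by (intro poly_eqI) (simp add: bounded_polys_def reflect_reflect)

lemma reflect_poly_t_scalar [simp]: "reflect_poly_t a (scalar c) = scalar c"
  by (intro poly_eqI) (simp add: scalar_def coeff_pCons split: nat.split)

lemma reflect_poly_t_monom_xpow [simp]: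
  "reflect_poly_t a (monom (xpow \<alpha>) 1) = monom (xpow (a - \<alpha>)) 1"
  by (intro poly_eqI) (auto simp: xpow_def)

text \<open>For products, exponents add, and so do the bounds \<open>nscale m a\<close> as t-degrees
  add.\<close>

lemma subalgebra_bounded_polys: "subalgebra (bounded_polys a)"
  unfolding subalgebra_def
proof (intro conjI ballI)
  show "range scalar \<subseteq> bounded_polys a"
    by (auto simp: bounded_polys_def scalar_def coeff_pCons expdvd_refl split: nat.splits if_splits)
next
  fix p q :: "('a, 'b) mpoly poly"
  assume "p \<in> bounded_polys a" "q \<in> bounded_polys a"
  then have p: "\<And>m b. b \<in> Poly_Mapping.keys (coeff p m) \<Longrightarrow> expdvd b (nscale m a)"
    and q: "\<And>m b. b \<in> Poly_Mapping.keys (coeff q m) \<Longrightarrow> expdvd b (nscale m a)"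
    by (auto simp: bounded_polys_def)
  show "p + q \<in> bounded_polys a"
    using p q by (force simp: bounded_polys_def dest!: subsetD[OF keys_add])
  show "p * q \<in> bounded_polys a"
    unfolding bounded_polys_def
  proof (intro CollectI allI ballI)
    fix k b
    assume "b \<in> Poly_Mapping.keys (coeff (p * q) k)"
    then have "b \<in> (\<Union>i\<in>{..k}. Poly_Mapping.keys (coeff p i * coeff q (k - i)))"
      unfolding coeff_mult by (rule subsetD[OF keys_sum])
    then obtain i where i: "i \<le> k" "b \<in> Poly_Mapping.keys (coeff p i * coeff q (k - i))" by blast
    then obtain u v where uv: "b = u + v" "u \<in> Poly_Mapping.keys (coeff p i)"
      "v \<in> Poly_Mapping.keys (coeff q (k - i))"
      using keys_mult[of "coeff p i" "coeff q (k - i)"] by blast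
    then have "expdvd (u + v) (nscale i a + nscale (k - i) a)"
      by (intro expdvd_add_mono p q)
    then show "expdvd b (nscale k a)" using i(1) uv(1) nscale_add[of i "k - i" a] by simp
  qed
qed

lemma subalgebra_reflect_preimage:
  assumes "subalgebra B"
  shows "subalgebra {p \<in> bounded_polys a. reflect_poly_t a p \<in> B}"
  using assms subalgebra_bounded_polys[of a]
  by (simp add: subalgebra_def reflect_poly_t_add reflect_poly_t_mult image_subset_iff) blast

text \<open>An intersection of subalgebras is a subalgebra, as \<open>hull_in\<close>
  demands.\<close>

lemma subalgebra_hull: "subalgebra (subalgebra hull S)"
  by (rule hull_in) (auto simp: subalgebra_def image_subset_iff)

text \<open>The right-hand side is a subalgebra, so by minimality of the hull only the generators f
  t need checking.\<close>

lemma hull_reflect_subset: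
  assumes "\<And>\<alpha>. \<alpha> \<in> A \<Longrightarrow> expdvd \<alpha> a"
  shows "subalgebra hull ((\<lambda>\<alpha>. monom (xpow \<alpha>) 1) ` A) \<subseteq>
    {p \<in> bounded_polys a. reflect_poly_t a p \<in>
      subalgebra hull ((\<lambda>\<alpha>. monom (xpow \<alpha>) 1 :: ('n, 'k::field) mpoly poly) ` (-) a ` A)}"
    (is "_ \<subseteq> {p \<in> _. _ \<in> ?H}")
proof (rule hull_minimal)
  have "monom (xpow \<alpha>) 1 \<in> bounded_polys a" if "\<alpha> \<in> A" for \<alpha>
    using assms[OF that] by (auto simp: bounded_polys_def xpow_def split: if_splits)
  then show "(\<lambda>\<alpha>. monom (xpow \<alpha>) 1) ` A \<subseteq> {p \<in> bounded_polys a. reflect_poly_t a p \<in> ?H}"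
    \<comment> \<open>The rule \<open>reflect_poly_t_monom_xpow\<close> matches the literal
      \<open>1\<close>, so \<open>1\<close> must not become \<open>Suc 0\<close>.\<close>
    by (auto simp del: One_nat_def intro!: hull_inc)
next
  show "subalgebra {p \<in> bounded_polys a. reflect_poly_t a p \<in> ?H}"
    by (intro subalgebra_reflect_preimage subalgebra_hull)
qed

theorem theorem3p1:
  fixes a :: "'n::finite \<Rightarrow>\<^sub>0 nat" and I :: "('n, 'k::field) mpoly set"
  assumes "monomial_ideal I"
    and "determined a I"
    and "equigenerated I"
  shows "algebra_isomorphic (special_fiber I) (special_fiber (newton_dual a I))"
proof -
  define A where "A = {\<alpha>. xpow \<alpha> \<in> min_gens I}"
  define E where "E = subalgebra hull ((\<lambda>\<alpha>. monom (xpow \<alpha>) 1 :: ('n, 'k) mpoly poly) ` A)"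
  define D where "D = subalgebra hull ((\<lambda>\<alpha>. monom (xpow \<alpha>) 1 :: ('n, 'k) mpoly poly) ` (-) a ` A)"
  have "min_gens I \<subseteq> range xpow"
    using is_min_gens_min_gens[OF assms(1)] by (simp add: is_min_gens_def)
  then have "min_gens I = xpow ` A" by (auto simp: A_def)
  then have fiber: "special_fiber I = E"
    by (simp add: special_fiber_def E_def image_image)
  have "min_gens (newton_dual a I) = {xpow (a - \<alpha>) | \<alpha>. xpow \<alpha> \<in> min_gens I}"
    unfolding newton_dual_def using theI'[OF dual_ex1[OF assms(1,2)]] by blast
  also have "\<dots> = xpow ` (-) a ` A" by (auto simp: A_def)
  finally have dual: "special_fiber (newton_dual a I) = D"
    by (simp add: special_fiber_def D_def image_image)
  have le: "expdvd \<alpha> a" if "\<alpha> \<in> A" for \<alpha>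
    using that assms(2) by (simp add: A_def determined_def expdvd_def)
  \<comment> \<open>Reflecting the dual exponents returns \<open>A\<close>, so
    \<open>hull_reflect_subset\<close> can also be applied starting from the dual generators, giving
    the inclusion \<open>DE\<close>.\<close>
  have "(-) a ` (-) a ` A = A"
    using le by (force simp: image_image diff_diff_expdvd)
  then have "E = subalgebra hull ((\<lambda>\<alpha>. monom (xpow \<alpha>) 1) ` (-) a ` (-) a ` A)"
    by (simp only: E_def)
  moreover have "expdvd \<beta> a" if "\<beta> \<in> (-) a ` A" for \<beta>
    using that by (auto simp: expdvd_def lookup_minus)
  ultimately have DE: "D \<subseteq> {p \<in> bounded_polys a. reflect_poly_t a p \<in> E}"
    using hull_reflect_subset[of "(-) a ` A" a] unfolding D_def by simp
  have ED: "E \<subseteq> {p \<in> bounded_polys a. reflect_poly_t a p \<in> D}"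
    unfolding D_def E_def using le by (rule hull_reflect_subset)
  \<comment> \<open>The map is its own inverse on both algebras, since \<open>ED\<close> and
    \<open>DE\<close> place them in \<open>bounded_polys a\<close>.\<close>
  have "bij_betw (reflect_poly_t a) E D"
    using ED DE by (intro bij_betw_byWitness[where f' = "reflect_poly_t a"])
      (auto simp: reflect_poly_t_involution)
  \<comment> \<open>Multiplicativity on \<open>E\<close> again rests on \<open>ED\<close>, which
    bounds its elements.\<close>
  then show ?thesis
    unfolding algebra_isomorphic_def fiber dual using ED
    by (intro exI[of _ "reflect_poly_t a"]) (auto simp: reflect_poly_t_add intro!: reflect_poly_t_mult)
qed

end
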